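(* Let $A$ be an Artin group. Then $A$ has property BVC if and only if $A$ is virtually cyclic.
   Context: An Artin group is a group with a presentation with finitely many generators $x_1,\dots,x_n$, where for each pair $i<j$ a number $m_{i,j}=m_{j,i}\in\{2,3,\dots\}\cup\{\infty\}$ is given, and the relations are $\langle x_i,x_j\rangle^{m_{i,j}}=\langle x_j,x_i\rangle^{m_{j,i}}$ for all $i<j$ with $m_{i,j}<\infty$. Here $\langle x_i,x_j\rangle^{m}$ denotes the alternating product of $x_i$ and $x_j$ of length $m$ beginning with $x_i$ (for example $\langle x_1,x_3\rangle^3=x_1x_3x_1$); if $m_{i,j}=\infty$ there is no relation between $x_i$ and $x_j$. A group $G$ has property BVC if $G$ has a finite set of virtually cyclic subgroups $\{V_1,\dots,V_n\}$ such that every virtually cyclic subgroup of $G$ is conjugate to a subgroup of some $V_i$. Finite groups count as virtually cyclic. *)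

theory Defs
  imports "HOL-Algebra.Elementary_Groups" "HOL-Library.Extended_Nat"
begin

section \<open>Groups given by generators and relations\<close>

text \<open>A letter is a generator with a sign: \<open>(x, True)\<close> stands for \<open>x\<close>
  and \<open>(x, False)\<close> for its formal inverse.\<close>

type_synonym 'g word = "('g \<times> bool) list"

abbreviation words_over :: "'g set \<Rightarrow> 'g word set" where
  "words_over S \<equiv> lists (S \<times> UNIV)"

text \<open>A pair \<open>(r, s) \<in> R\<close> is the relation \<open>r = s\<close>. Pairs involving letters outside
  \<open>S\<close> are ignored.\<close>

inductive pres_cong :: "'g set \<Rightarrow> ('g word \<times> 'g word) set \<Rightarrow> 'g word \<Rightarrow> 'g word \<Rightarrow> bool"
  for S R where
  refl: "u \<in> words_over S \<Longrightarrow> pres_cong S R u u"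
| sym: "pres_cong S R u v \<Longrightarrow> pres_cong S R v u"
| trans: "pres_cong S R u v \<Longrightarrow> pres_cong S R v w \<Longrightarrow> pres_cong S R u w"
| append: "pres_cong S R u u' \<Longrightarrow> pres_cong S R v v' \<Longrightarrow> pres_cong S R (u @ v) (u' @ v')"
| cancel: "x \<in> S \<Longrightarrow> pres_cong S R [(x, b), (x, \<not> b)] []"
| relation: "(r, s) \<in> R \<Longrightarrow> r \<in> words_over S \<Longrightarrow> s \<in> words_over S \<Longrightarrow> pres_cong S R r s"

definition pres_rel :: "'g set \<Rightarrow> ('g word \<times> 'g word) set \<Rightarrow> ('g word \<times> 'g word) set" where
  "pres_rel S R = {(u, v). pres_cong S R u v}"

definition presented_group ::
  "'g set \<Rightarrow> ('g word \<times> 'g word) set \<Rightarrow> 'g word set monoid" where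
  "presented_group S R =
    \<lparr>carrier = words_over S // pres_rel S R,
     mult = (\<lambda>X Y. \<Union>u\<in>X. \<Union>v\<in>Y. pres_rel S R `` {u @ v}),
     one = pres_rel S R `` {[]}\<rparr>"

lemma pres_cong_words:
  "pres_cong S R u v \<Longrightarrow> u \<in> words_over S \<and> v \<in> words_over S"
  by (induction rule: pres_cong.induct) auto

lemma equiv_pres_rel: "equiv (words_over S) (pres_rel S R)"
proof (rule equivI)
  show "pres_rel S R \<subseteq> words_over S \<times> words_over S"
    using pres_cong_words[of S R] unfolding pres_rel_def by blast
  show "refl_on (words_over S) (pres_rel S R)"
    unfolding refl_on_def pres_rel_def using pres_cong.refl[of _ S R] by blast
  show "Relation.sym (pres_rel S R)"
    unfolding Relation.sym_def pres_rel_def using pres_cong.sym[of S R] by blast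
  show "Relation.trans (pres_rel S R)"
    unfolding Relation.trans_def pres_rel_def using pres_cong.trans[of S R] by blast
qed

lemma presented_group_mult:
  assumes "u \<in> words_over S" "v \<in> words_over S"
  shows "pres_rel S R `` {u} \<otimes>\<^bsub>presented_group S R\<^esub> pres_rel S R `` {v}
       = pres_rel S R `` {u @ v}"
proof -
  have "congruent2 (pres_rel S R) (pres_rel S R) (\<lambda>u v. pres_rel S R `` {u @ v})"
    unfolding congruent2_def using equiv_class_eq[OF equiv_pres_rel[of S R]]
    by (auto simp: pres_rel_def intro: pres_cong.append)
  from UN_equiv_class2[OF equiv_pres_rel equiv_pres_rel this assms]
  show ?thesis by (simp add: presented_group_def)
qed

lemma presented_group_carrierE:
  assumes "X \<in> carrier (presented_group S R)"
  obtains u where "u \<in> words_over S" "X = pres_rel S R `` {u}"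
proof -
  have "X \<in> words_over S // pres_rel S R" using assms by (simp add: presented_group_def)
  then show thesis by (rule quotientE) (rule that)
qed

lemma presented_group_carrierI:
  "u \<in> words_over S \<Longrightarrow> pres_rel S R `` {u} \<in> carrier (presented_group S R)"
  by (auto simp: presented_group_def intro: quotientI)

lemma pres_cong_left_inverse:
  assumes "u \<in> words_over S"
  shows "pres_cong S R (rev (map (\<lambda>(x, b). (x, \<not> b)) u) @ u) []"
  using assms
proof (induction u rule: list.induct)
  case Nil
  then show ?case by (simp add: pres_cong.refl)
next
  case (Cons a u)
  obtain x b where a: "a = (x, b)" by force
  let ?v = "rev (map (\<lambda>(x, b). (x, \<not> b)) u)"
  have x: "x \<in> S" and u: "u \<in> words_over S" using Cons.prems by (simp_all add: a)
  have v: "?v \<in> words_over S" using u by (induction u) auto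
  have "pres_cong S R [(x, \<not> b), (x, b)] []"
    using pres_cong.cancel[OF x, of R "\<not> b"] by simp
  from pres_cong.append[OF pres_cong.refl[OF v] pres_cong.append[OF this pres_cong.refl[OF u]]]
  have "pres_cong S R (?v @ [(x, \<not> b), (x, b)] @ u) (?v @ u)" by simp
  then show ?case using Cons.IH[OF u] a by (auto intro: pres_cong.trans)
qed

lemma group_presented_group: "group (presented_group S R)"
proof (rule groupI)
  let ?P = "presented_group S R"
  have one: "\<one>\<^bsub>?P\<^esub> = pres_rel S R `` {[]}" by (simp add: presented_group_def)
  show "\<one>\<^bsub>?P\<^esub> \<in> carrier ?P" unfolding one by (rule presented_group_carrierI) simp
  fix X assume "X \<in> carrier ?P"
  then obtain u where u: "u \<in> words_over S" "X = pres_rel S R `` {u}"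
    by (rule presented_group_carrierE)
  show "\<one>\<^bsub>?P\<^esub> \<otimes>\<^bsub>?P\<^esub> X = X"
    unfolding one u(2) using presented_group_mult[of "[]" S u R] u(1) by simp
  let ?v = "rev (map (\<lambda>(x, b). (x, \<not> b)) u)"
  have v: "?v \<in> words_over S" using u(1) by (induction u) auto
  have "pres_rel S R `` {?v} \<otimes>\<^bsub>?P\<^esub> X = \<one>\<^bsub>?P\<^esub>"
    unfolding one u(2) presented_group_mult[OF v u(1)]
    by (rule equiv_class_eq[OF equiv_pres_rel])
       (simp add: pres_rel_def pres_cong_left_inverse[OF u(1)])
  then show "\<exists>Y\<in>carrier ?P. Y \<otimes>\<^bsub>?P\<^esub> X = \<one>\<^bsub>?P\<^esub>"
    using presented_group_carrierI[OF v] by blast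
  fix Y assume "Y \<in> carrier ?P"
  then obtain v where v: "v \<in> words_over S" "Y = pres_rel S R `` {v}"
    by (rule presented_group_carrierE)
  show "X \<otimes>\<^bsub>?P\<^esub> Y \<in> carrier ?P"
    unfolding u(2) v(2) presented_group_mult[OF u(1) v(1)]
    by (rule presented_group_carrierI) (use u(1) v(1) in simp)
  fix Z assume "Z \<in> carrier ?P"
  then obtain w where w: "w \<in> words_over S" "Z = pres_rel S R `` {w}"
    by (rule presented_group_carrierE)
  have uv: "u @ v \<in> words_over S" and vw: "v @ w \<in> words_over S"
    using u(1) v(1) w(1) by auto
  show "X \<otimes>\<^bsub>?P\<^esub> Y \<otimes>\<^bsub>?P\<^esub> Z = X \<otimes>\<^bsub>?P\<^esub> (Y \<otimes>\<^bsub>?P\<^esub> Z)"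
    unfolding u(2) v(2) w(2)
    by (simp only: presented_group_mult u(1) v(1) w(1) uv vw append_assoc)
qed

section \<open>Artin groups\<close>

fun alt_word :: "'g \<Rightarrow> 'g \<Rightarrow> nat \<Rightarrow> 'g word" where
  "alt_word x y 0 = []"
| "alt_word x y (Suc k) = (x, True) # alt_word y x k"

definition artin_matrix :: "nat \<Rightarrow> (nat \<Rightarrow> nat \<Rightarrow> enat) \<Rightarrow> bool" where
  "artin_matrix n m \<longleftrightarrow>
    (\<forall>i\<in>{1..n}. \<forall>j\<in>{1..n}. i \<noteq> j \<longrightarrow> m i j = m j i \<and> 2 \<le> m i j)"

definition artin_relations ::
  "nat \<Rightarrow> (nat \<Rightarrow> nat \<Rightarrow> enat) \<Rightarrow> (nat word \<times> nat word) set" where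
  "artin_relations n m =
    {(alt_word i j k, alt_word j i k) | i j k. 1 \<le> i \<and> i < j \<and> j \<le> n \<and> m i j = enat k}"

definition artin_group :: "('a, 'b) monoid_scheme \<Rightarrow> bool" where
  "artin_group A \<longleftrightarrow> group A \<and>
    (\<exists>n m. artin_matrix n m \<and> A \<cong> presented_group {1..n} (artin_relations n m))"

section \<open>Virtually cyclic groups and property BVC\<close>

definition virtually_cyclic :: "('a, 'b) monoid_scheme \<Rightarrow> bool" where
  "virtually_cyclic G \<longleftrightarrow>
    (\<exists>C. subgroup C G \<and> cyclic_group (G\<lparr>carrier := C\<rparr>) \<and> finite (rcosets\<^bsub>G\<^esub> C))"

definition vc_subgroup :: "'a set \<Rightarrow> ('a, 'b) monoid_scheme \<Rightarrow> bool" where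
  "vc_subgroup H G \<longleftrightarrow> subgroup H G \<and> virtually_cyclic (G\<lparr>carrier := H\<rparr>)"

definition BVC :: "('a, 'b) monoid_scheme \<Rightarrow> bool" where
  "BVC G \<longleftrightarrow>
    (\<exists>\<V>. finite \<V> \<and> (\<forall>V\<in>\<V>. vc_subgroup V G) \<and>
      (\<forall>H. vc_subgroup H G \<longrightarrow>
        (\<exists>V\<in>\<V>. \<exists>g\<in>carrier G. g <#\<^bsub>G\<^esub> H #>\<^bsub>G\<^esub> inv\<^bsub>G\<^esub> g \<subseteq> V)))"

end

theory Submission
  imports Defs Complex_Main
begin

text \<open>
  A virtually cyclic group is covered by itself, so it has BVC. For the converse let \<open>A\<close> be an
  Artin group on \<open>n\<close> generators. If \<open>n \<le> 1\<close>, then \<open>A\<close> is cyclic. If \<open>n \<ge> 2\<close>, then \<open>A\<close> does not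
  have BVC, whatever the exponents are, for the following reason.

  Both sides of a braid relation have the same length, so there is a homomorphism
  \<open>d : A \<rightarrow> \<int>\<close> sending every generator to \<open>1\<close>. A virtually cyclic group contains only finitely many
  elements of a given degree \<open>N \<noteq> 0\<close> (\<open>virtually_cyclic_finite_fibre\<close>). Under BVC every element
  of degree \<open>N\<close> is conjugate into one of finitely many virtually cyclic subgroups, so only
  finitely many conjugacy classes have degree \<open>N\<close>
  (\<open>not_BVC_if_infinitely_many_classes\<close>). But the elements
  \<open>x\<^sub>1\<^bsup>2k+2\<^esup> x\<^sub>2\<^bsup>-2k\<^esup>\<close>, which all have degree \<open>2\<close>, are pairwise not conjugate.

  To see this, let \<open>W\<close> be the Coxeter group with the same exponents and \<open>s\<^sub>i\<close> its generators, and
  send \<open>x\<^sub>i\<close> to the pair \<open>(e(s\<^sub>i), s\<^sub>i)\<close> in the semidirect product of \<open>W\<close> with the functions from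
  reflections to \<open>\<int>\<close>; here \<open>e(s)\<close> is the indicator function of \<open>s\<close>. The braid relations are
  respected because both alternating products of length \<open>m\<close> of \<open>s\<close> and \<open>t\<close> meet the same
  \<open>m\<close> reflections \<open>(st)\<^sup>l s\<close>, in opposite orders (\<open>refl_step_braid\<close>). Squares \<open>x\<^sub>i\<^sup>2\<close> go to
  \<open>2 e(s\<^sub>i)\<close>, so that the element above is sent to the function with values
  \<open>2k+2\<close> at \<open>s\<^sub>1\<close>, \<open>-2k\<close> at \<open>s\<^sub>2\<close> and \<open>0\<close> elsewhere. Conjugation permutes the arguments of such a
  function and keeps its set of values, and the largest value determines \<open>k\<close>. This uses
  \<open>s\<^sub>1 \<noteq> s\<^sub>2\<close>, which is visible in the geometric representation of \<open>W\<close>.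

  In the formal proof \<open>W\<close> is replaced by the functions on the space of its dual geometric
  representation, and the semidirect product by the permutations of
  \<open>(functions) \<times> \<int>\<close> that commute with translation in the second coordinate.
\<close>

section \<open>Homomorphisms out of a presented group\<close>

definition letter_value :: "('h, 'c) monoid_scheme \<Rightarrow> ('g \<Rightarrow> 'h) \<Rightarrow> 'g \<times> bool \<Rightarrow> 'h" where
  "letter_value H f = (\<lambda>(x, b). if b then f x else inv\<^bsub>H\<^esub> (f x))"

definition word_value :: "('h, 'c) monoid_scheme \<Rightarrow> ('g \<Rightarrow> 'h) \<Rightarrow> 'g word \<Rightarrow> 'h" where
  "word_value H f u = foldr (\<lambda>a h. letter_value H f a \<otimes>\<^bsub>H\<^esub> h) u \<one>\<^bsub>H\<^esub>"

definition pres_gen :: "'g set \<Rightarrow> ('g word \<times> 'g word) set \<Rightarrow> 'g \<Rightarrow> 'g word set" where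
  "pres_gen S R x = pres_rel S R `` {[(x, True)]}"

lemma word_value_Nil [simp]: "word_value H f [] = \<one>\<^bsub>H\<^esub>"
  and word_value_Cons [simp]:
    "word_value H f (a # u) = letter_value H f a \<otimes>\<^bsub>H\<^esub> word_value H f u"
  by (simp_all add: word_value_def)

context group
begin

lemma letter_value_closed:
  "f \<in> S \<rightarrow> carrier G \<Longrightarrow> a \<in> S \<times> UNIV \<Longrightarrow> letter_value G f a \<in> carrier G"
  by (auto simp: letter_value_def intro!: inv_closed elim: funcset_mem)

lemma word_value_closed:
  "f \<in> S \<rightarrow> carrier G \<Longrightarrow> u \<in> words_over S \<Longrightarrow> word_value G f u \<in> carrier G"
proof (induction u)
  case (Cons a u)
  then have "letter_value G f a \<in> carrier G"
    by (intro letter_value_closed[OF Cons.prems(1)]) auto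
  then show ?case using Cons by simp
qed simp

lemma word_value_append:
  assumes f: "f \<in> S \<rightarrow> carrier G" and "u \<in> words_over S" "v \<in> words_over S"
  shows "word_value G f (u @ v) = word_value G f u \<otimes> word_value G f v"
  using assms(2)
proof (induction u)
  case Nil
  then show ?case using word_value_closed[OF f assms(3)] by simp
next
  case (Cons a u)
  then show ?case
    using letter_value_closed[OF f, of a] word_value_closed[OF f, of u]
      word_value_closed[OF f assms(3)]
    by (auto simp: m_assoc)
qed

lemma word_value_cong:
  assumes f: "f \<in> S \<rightarrow> carrier G"
    and rel: "\<And>r s. (r, s) \<in> R \<Longrightarrow> r \<in> words_over S \<Longrightarrow> s \<in> words_over S \<Longrightarrow>
      word_value G f r = word_value G f s"
    and "pres_cong S R u v"
  shows "word_value G f u = word_value G f v"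
  using assms(3)
proof (induction rule: pres_cong.induct)
  case (append u u' v v')
  then show ?case
    using pres_cong_words[OF append.hyps(1)] pres_cong_words[OF append.hyps(2)]
    by (simp add: word_value_append[OF f])
next
  case (cancel x b)
  then have "f x \<in> carrier G" using f by auto
  then show ?case by (simp add: letter_value_def)
qed (auto intro: rel)

text \<open>Von Dyck's theorem: evaluation of words in \<open>G\<close> is constant on the classes of \<open>pres_cong\<close>
  because it respects each of the generating moves, so it can be computed on any
  representative.\<close>

theorem presented_group_hom_exists:
  assumes f: "f \<in> S \<rightarrow> carrier G"
    and rel: "\<And>r s. (r, s) \<in> R \<Longrightarrow> r \<in> words_over S \<Longrightarrow> s \<in> words_over S \<Longrightarrow>
      word_value G f r = word_value G f s"
  obtains h where "h \<in> hom (presented_group S R) G"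
    and "\<And>x. x \<in> S \<Longrightarrow> h (pres_gen S R x) = f x"
proof
  define h where "h = (\<lambda>X. word_value G f (SOME u. u \<in> X))"
  have h: "h (pres_rel S R `` {u}) = word_value G f u" if "u \<in> words_over S" for u
  proof -
    have "u \<in> pres_rel S R `` {u}"
      using that by (simp add: pres_rel_def pres_cong.refl)
    then have "(SOME v. v \<in> pres_rel S R `` {u}) \<in> pres_rel S R `` {u}"
      by (rule someI)
    then have "pres_cong S R u (SOME v. v \<in> pres_rel S R `` {u})"
      by (simp add: pres_rel_def)
    from word_value_cong[OF f rel this] show ?thesis by (simp add: h_def)
  qed
  show "h \<in> hom (presented_group S R) G"
  proof (rule homI)
    fix X assume "X \<in> carrier (presented_group S R)"
    then obtain u where u: "u \<in> words_over S" "X = pres_rel S R `` {u}"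
      by (rule presented_group_carrierE)
    then show "h X \<in> carrier G" using h word_value_closed[OF f] by simp
    fix Y assume "Y \<in> carrier (presented_group S R)"
    then obtain v where v: "v \<in> words_over S" "Y = pres_rel S R `` {v}"
      by (rule presented_group_carrierE)
    have "u @ v \<in> words_over S" using u v by simp
    then show "h (X \<otimes>\<^bsub>presented_group S R\<^esub> Y) = h X \<otimes> h Y"
      using u v by (simp add: presented_group_mult h word_value_append[OF f])
  qed
  fix x assume "x \<in> S"
  then have "f x \<in> carrier G" using f by auto
  then show "h (pres_gen S R x) = f x"
    using \<open>x \<in> S\<close> h[of "[(x, True)]"] by (simp add: pres_gen_def letter_value_def)
qed

end

lemma pres_gen_closed: "x \<in> S \<Longrightarrow> pres_gen S R x \<in> carrier (presented_group S R)"
  unfolding pres_gen_def by (rule presented_group_carrierI) simp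

text \<open>The inclusion, rather than an equality, lets the presentation without generators share the
  proof: the cyclic generator is then the neutral element.\<close>

lemma presented_group_cyclic:
  assumes S: "S \<subseteq> {x}"
  shows "cyclic_group (presented_group S R)"
proof -
  let ?P = "presented_group S R"
  interpret P: group ?P by (rule group_presented_group)
  define g where "g = (if x \<in> S then pres_gen S R x else \<one>\<^bsub>?P\<^esub>)"
  have g: "g \<in> carrier ?P" by (simp add: g_def pres_gen_closed)
  have one: "\<one>\<^bsub>?P\<^esub> = pres_rel S R `` {[]}" by (simp add: presented_group_def)
  have letter: "pres_rel S R `` {[(y, b)]} \<in> range (\<lambda>k::int. g [^]\<^bsub>?P\<^esub> k)" if "y \<in> S" for y b
  proof -
    have y: "y = x" "x \<in> S" using S that by auto
    have pos: "pres_rel S R `` {[(x, True)]} = g [^]\<^bsub>?P\<^esub> (1::int)"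
      using y g P.int_pow_1[of g] by (simp add: g_def pres_gen_def)
    have "pres_rel S R `` {[(x, False)]} \<otimes>\<^bsub>?P\<^esub> g = \<one>\<^bsub>?P\<^esub>"
    proof -
      have "pres_cong S R [(x, False), (x, True)] []"
        using pres_cong.cancel[of x S R False] y by simp
      then have "pres_rel S R `` {[(x, False), (x, True)]} = pres_rel S R `` {[]}"
        by (intro equiv_class_eq[OF equiv_pres_rel]) (simp add: pres_rel_def)
      then show ?thesis
        using y presented_group_mult[of "[(x, False)]" S "[(x, True)]" R]
        by (simp add: g_def pres_gen_def one)
    qed
    then have "inv\<^bsub>?P\<^esub> g = pres_rel S R `` {[(x, False)]}"
      using g y by (intro P.inv_equality) (auto intro: presented_group_carrierI)
    moreover have "inv\<^bsub>?P\<^esub> g = g [^]\<^bsub>?P\<^esub> (-1::int)"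
      using g P.int_pow_neg[of g 1] P.int_pow_1[of g] by simp
    ultimately show ?thesis using pos y by (cases b) auto
  qed
  have word: "pres_rel S R `` {u} \<in> range (\<lambda>k::int. g [^]\<^bsub>?P\<^esub> k)" if "u \<in> words_over S" for u
    using that
  proof (induction u)
    case Nil
    then show ?case using int_pow_0[of ?P g] one by (metis rangeI)
  next
    case (Cons a u)
    obtain y b where a: "a = (y, b)" by force
    from Cons a have "y \<in> S" and u: "u \<in> words_over S" by auto
    then have "pres_rel S R `` {a # u}
        = pres_rel S R `` {[(y, b)]} \<otimes>\<^bsub>?P\<^esub> pres_rel S R `` {u}"
      using presented_group_mult[of "[(y, b)]" S u R] a by simp
    moreover obtain k l :: int where "pres_rel S R `` {[(y, b)]} = g [^]\<^bsub>?P\<^esub> k"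
      and "pres_rel S R `` {u} = g [^]\<^bsub>?P\<^esub> l"
      using letter[OF \<open>y \<in> S\<close>, of b] Cons.IH u by auto
    ultimately have "pres_rel S R `` {a # u} = g [^]\<^bsub>?P\<^esub> (k + l)"
      using g by (simp add: P.int_pow_mult)
    then show ?case by blast
  qed
  have "carrier ?P \<subseteq> range (\<lambda>k::int. g [^]\<^bsub>?P\<^esub> k)"
    by (auto elim!: presented_group_carrierE intro: word)
  then show ?thesis unfolding P.cyclic_group using g by auto
qed

section \<open>Virtually cyclic subgroups and homomorphisms to the integers\<close>

lemma (in group) same_coset_pow:
  assumes C: "subgroup C G" "C = range (\<lambda>i::int. c [^] i)" "c \<in> carrier G"
    and uv: "u \<in> carrier G" "v \<in> carrier G" "C #> u = C #> v"
  obtains i :: int where "u = c [^] i \<otimes> v"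
proof -
  have "u \<in> C #> v" using uv(1,3) rcos_self[OF _ C(1)] by blast
  then show thesis using that C(2) by (auto simp: r_coset_def)
qed

text \<open>Let \<open>C\<close> be a cyclic subgroup of finite index. If \<open>d\<close> vanishes on \<open>C\<close>, then it vanishes
  everywhere, because some quotient of two different powers of each element lies in \<open>C\<close> and
  \<open>\<int>\<close> is torsion-free. Otherwise \<open>d\<close> is injective on \<open>C\<close>, hence on every coset of \<open>C\<close>, so that
  each of the finitely many cosets contributes at most one element.\<close>

lemma virtually_cyclic_finite_fibre:
  fixes G (structure)
  assumes G: "group G" and vc: "virtually_cyclic G"
    and d: "d \<in> hom G integer_group" and N: "N \<noteq> 0"
  shows "finite {v \<in> carrier G. d v = N}"
proof -
  interpret group G by fact
  interpret d: group_hom G integer_group d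
    by (simp add: group_hom_def group_hom_axioms_def d G)
  obtain C where C: "subgroup C G" "cyclic_group (G\<lparr>carrier := C\<rparr>)" "finite (rcosets C)"
    using vc unfolding virtually_cyclic_def by blast
  interpret C: group "G\<lparr>carrier := C\<rparr>"
    using C(1) by (simp add: subgroup_imp_group)
  have "\<exists>c\<in>C. C = range (\<lambda>i::int. c [^]\<^bsub>G\<lparr>carrier := C\<rparr>\<^esub> i)"
  proof -
    have "carrier (G\<lparr>carrier := C\<rparr>) = C" by simp
    then show ?thesis using C(2) unfolding C.cyclic_group by metis
  qed
  then obtain c where c: "c \<in> C" "C = range (\<lambda>i::int. c [^]\<^bsub>G\<lparr>carrier := C\<rparr>\<^esub> i)"
    by (rule bexE)
  have C_sub: "C \<subseteq> carrier G" by (rule subgroup.subset[OF C(1)])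
  have c_carrier: "c \<in> carrier G" using subgroup.mem_carrier[OF C(1) c(1)] .
  have "(\<lambda>i::int. c [^]\<^bsub>G\<lparr>carrier := C\<rparr>\<^esub> i) = (\<lambda>i. c [^] i)"
    by (rule ext) (rule int_pow_consistent[OF C(1) c(1), symmetric])
  then have "range (\<lambda>i::int. c [^]\<^bsub>G\<lparr>carrier := C\<rparr>\<^esub> i) = range (\<lambda>i::int. c [^] i)"
    by (rule arg_cong)
  with c(2) have C_pow: "C = range (\<lambda>i::int. c [^] i)" by (rule HOL.trans)
  note coset = same_coset_pow[OF C(1) C_pow c_carrier]
  have d_pow: "d (c [^] i \<otimes> v) = i * d c + d v" if "v \<in> carrier G" for i :: int and v
    using that c_carrier by (simp add: d.hom_int_pow)
  show ?thesis
  proof (cases "d c = 0")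
    case True
    have "d v \<noteq> N" if v: "v \<in> carrier G" for v
    proof
      assume dv: "d v = N"
      have "range (\<lambda>k::nat. C #> v [^] k) \<subseteq> rcosets C"
        using v by (auto intro!: rcosetsI[OF C_sub])
      then have "\<not> inj (\<lambda>k::nat. C #> v [^] k)"
        using C(3) finite_imageD finite_subset infinite_UNIV_nat by blast
      then obtain k l :: nat where kl: "k \<noteq> l" "C #> v [^] k = C #> v [^] l"
        unfolding inj_def by blast
      then obtain i :: int where "v [^] k = c [^] i \<otimes> v [^] l"
        using coset[of "v [^] k" "v [^] l"] v by auto
      then have "d (v [^] k) = d (v [^] l)" using d_pow[of "v [^] l" i] v True by simp
      then have "int k * N = int l * N" using v dv by (simp add: d.hom_nat_pow)
      then show False using kl(1) N by simp
    qed
    then have "{v \<in> carrier G. d v = N} = {}" by blast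
    then show ?thesis by (simp only: finite.emptyI)
  next
    case False
    have "inj_on (\<lambda>v. C #> v) {v \<in> carrier G. d v = N}"
    proof (rule inj_onI)
      fix u v
      assume "u \<in> {v \<in> carrier G. d v = N}" "v \<in> {v \<in> carrier G. d v = N}" "C #> u = C #> v"
      then have *: "u \<in> carrier G" "v \<in> carrier G" "C #> u = C #> v" "d u = d v" by simp_all
      then obtain i :: int where i: "u = c [^] i \<otimes> v" using coset by blast
      then have "i = 0" using d_pow[of v i] * False by simp
      then show "u = v" using i *(2) by simp
    qed
    moreover have "(\<lambda>v. C #> v) ` {v \<in> carrier G. d v = N} \<subseteq> rcosets C"
      by (auto intro!: rcosetsI[OF C_sub])
    ultimately show ?thesis using C(3) by (meson inj_on_finite)
  qed
qed

lemma virtually_cyclic_if_cyclic_group: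
  fixes G (structure)
  assumes "group G" "cyclic_group G"
  shows "virtually_cyclic G"
proof -
  interpret group G by fact
  have "rcosets (carrier G) = {carrier G}"
    using coset_join2[OF _ subgroup_self] by (auto simp: RCOSETS_def)
  then show ?thesis
    unfolding virtually_cyclic_def using assms(2) subgroup_self
    by (intro exI[of _ "carrier G"]) simp
qed

lemma (in group) vc_subgroup_powers:
  assumes "g \<in> carrier G"
  shows "vc_subgroup (generate G {g}) G"
proof -
  have sub: "subgroup (generate G {g}) G" using assms by (simp add: generate_is_subgroup)
  have "subgroup_generated G {g} = G\<lparr>carrier := generate G {g}\<rparr>"
    using assms by (simp add: subgroup_generated_def)
  then show ?thesis
    unfolding vc_subgroup_def
    using sub virtually_cyclic_if_cyclic_group[of "G\<lparr>carrier := generate G {g}\<rparr>"]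
      cyclic_group_generated[of g] subgroup_imp_group
    by simp
qed

text \<open>The cyclic subgroups generated by the \<open>g k\<close> would all be conjugated into finitely many
  virtually cyclic subgroups. Conjugation does not change \<open>d\<close>, so infinitely many different
  conjugates would lie in the union of finitely many finite fibres of \<open>d\<close> over \<open>N\<close>.\<close>

lemma not_BVC_if_infinitely_many_classes:
  fixes G (structure)
  assumes G: "group G" and d: "d \<in> hom G integer_group" and N: "N \<noteq> 0"
    and g: "\<And>k::nat. g k \<in> carrier G" "\<And>k. d (g k) = N"
    and nonconj: "\<And>k l a. a \<in> carrier G \<Longrightarrow> a \<otimes> g k \<otimes> inv a = g l \<Longrightarrow> k = l"
  shows "\<not> BVC G"
proof
  interpret group G by fact
  interpret d: group_hom G integer_group d
    by (simp add: group_hom_def group_hom_axioms_def d G)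
  assume "BVC G"
  then obtain \<V> where \<V>: "finite \<V>" "\<And>V. V \<in> \<V> \<Longrightarrow> vc_subgroup V G"
    and cover: "\<And>H. vc_subgroup H G \<Longrightarrow> \<exists>V\<in>\<V>. \<exists>a\<in>carrier G. a <# H #> inv a \<subseteq> V"
    unfolding BVC_def by blast
  define F where "F = (\<Union>V\<in>\<V>. {v \<in> V. d v = N})"
  have "finite {v \<in> V. d v = N}" if "V \<in> \<V>" for V
  proof -
    have V: "subgroup V G" "virtually_cyclic (G\<lparr>carrier := V\<rparr>)"
      using \<V>(2)[OF that] by (auto simp: vc_subgroup_def)
    have "d \<in> hom (G\<lparr>carrier := V\<rparr>) integer_group"
      using d subgroup.mem_carrier[OF V(1)] by (auto simp: hom_def)
    from virtually_cyclic_finite_fibre[OF subgroup_imp_group[OF V(1)] V(2) this N]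
    show ?thesis by simp
  qed
  then have "finite F" using \<V>(1) by (simp add: F_def)
  have "\<exists>a\<in>carrier G. a \<otimes> g k \<otimes> inv a \<in> F" for k
  proof -
    obtain V a where V: "V \<in> \<V>" "a \<in> carrier G" "a <# generate G {g k} #> inv a \<subseteq> V"
      using cover[OF vc_subgroup_powers[OF g(1)]] by blast
    have "g k \<in> generate G {g k}" by (simp add: generate.incl)
    then have "a \<otimes> g k \<otimes> inv a \<in> a <# generate G {g k} #> inv a"
      by (auto simp: l_coset_def r_coset_def)
    moreover have "d (a \<otimes> g k \<otimes> inv a) = N"
      using V(2) g by simp
    ultimately show ?thesis using V by (auto simp: F_def)
  qed
  then obtain a where a: "\<And>k. a k \<in> carrier G" "\<And>k. a k \<otimes> g k \<otimes> inv (a k) \<in> F" by metis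
  have "inj (\<lambda>k. a k \<otimes> g k \<otimes> inv (a k))"
  proof (rule injI)
    fix k l assume eq: "a k \<otimes> g k \<otimes> inv (a k) = a l \<otimes> g l \<otimes> inv (a l)"
    let ?b = "inv (a l) \<otimes> a k"
    have "?b \<otimes> g k \<otimes> inv ?b = inv (a l) \<otimes> (a k \<otimes> g k \<otimes> inv (a k)) \<otimes> a l"
      using a(1) g(1) by (simp add: inv_mult_group m_assoc)
    also have "\<dots> = (inv (a l) \<otimes> a l) \<otimes> g l \<otimes> (inv (a l) \<otimes> a l)"
      unfolding eq using a(1)[of l] g(1)[of l] by (simp only: m_assoc m_closed inv_closed)
    also have "\<dots> = g l" using a(1) g(1) by simp
    finally show "k = l" using nonconj[of ?b k l] a(1) by simp
  qed
  moreover have "range (\<lambda>k. a k \<otimes> g k \<otimes> inv (a k)) \<subseteq> F" using a(2) by blast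
  ultimately show False
    using \<open>finite F\<close> by (meson infinite_UNIV_nat inj_on_finite)
qed

lemma BVC_if_virtually_cyclic:
  fixes G (structure)
  assumes G: "group G" and vc: "virtually_cyclic G"
  shows "BVC G"
proof -
  interpret group G by fact
  have "vc_subgroup (carrier G) G" using vc by (simp add: vc_subgroup_def subgroup_self)
  moreover have "\<one> <# H #> inv \<one> \<subseteq> carrier G" if "vc_subgroup H G" for H
  proof -
    have "H \<subseteq> carrier G" using that by (simp add: vc_subgroup_def subgroup.subset)
    then show ?thesis by (intro r_coset_subset_G l_coset_subset_G) simp_all
  qed
  ultimately show ?thesis
    unfolding BVC_def by (intro exI[of _ "{carrier G}"]) (blast intro: one_closed)
qed

section \<open>Coxeter reflections\<close>

text \<open>The dual of the geometric representation: \<open>f\<close> is a linear form, given by its values on the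
  simple roots \<open>\<alpha>\<^sub>j\<close>, and the reflection maps \<open>\<alpha>\<^sub>j\<close> to \<open>\<alpha>\<^sub>j - 2 B i j \<alpha>\<^sub>i\<close>. Passing to linear forms
  avoids sums over the simple roots and any condition of finite support.\<close>

definition reflection :: "('i \<Rightarrow> 'i \<Rightarrow> real) \<Rightarrow> 'i \<Rightarrow> ('i \<Rightarrow> real) \<Rightarrow> 'i \<Rightarrow> real" where
  "reflection B i f = (\<lambda>j. f j - 2 * B i j * f i)"

lemma reflection_involution: "B i i = 1 \<Longrightarrow> reflection B i \<circ> reflection B i = id"
  by (auto simp: reflection_def fun_eq_iff)

text \<open>The form that is \<open>1\<close> on the \<open>i\<close>-th simple root and \<open>0\<close> on the others distinguishes them.\<close>

lemma reflection_neq: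
  assumes "B i i = 1" "i \<noteq> j"
  shows "reflection B i \<noteq> reflection B j"
proof
  assume "reflection B i = reflection B j"
  then have "reflection B i (\<lambda>l. of_bool (l = i)) i = reflection B j (\<lambda>l. of_bool (l = i)) i"
    by simp
  then show False using assms by (simp add: reflection_def)
qed

text \<open>On the values \<open>f i\<close> and \<open>f j\<close> the product of the two reflections acts as a rotation by
  \<open>2 \<theta>\<close>, written in the basis of two simple roots; its powers have entries of the form
  \<open>sin (q \<theta>) / sin \<theta>\<close>. Each single reflection changes every other value of \<open>f\<close> by a
  multiple of the current value at \<open>i\<close> or \<open>j\<close>, and the accumulated changes telescope to the
  products of sines below. The factor \<open>(sin \<theta>)\<^sup>2\<close> clears the denominators. What matters is that all
  corrections contain the factor \<open>sin (k \<theta>)\<close>.\<close>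

lemma reflection_pair_pow:
  fixes \<theta> :: real
  assumes B: "B i i = 1" "B j j = 1" "B i j = - cos \<theta>" "B j i = - cos \<theta>"
  shows "(sin \<theta>)\<^sup>2 * (((reflection B j \<circ> reflection B i) ^^ k) f l) = (sin \<theta>)\<^sup>2 * f l
    - 2 * B i l * (f i * (sin (k * \<theta>))\<^sup>2 + f j * sin (k * \<theta>) * sin ((real k - 1) * \<theta>))
    - 2 * B j l * (f i * sin (k * \<theta>) * sin ((real k + 1) * \<theta>) + f j * (sin (k * \<theta>))\<^sup>2)"
proof (induction k arbitrary: l)
  case 0
  then show ?case by simp
next
  case (Suc k)
  define h where "h = ((reflection B j \<circ> reflection B i) ^^ k) f"
  define S where "S = sin \<theta>" define c where "c = cos \<theta>"
  define s where "s = sin (k * \<theta>)" define C where "C = cos (k * \<theta>)"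
  have rel: "S\<^sup>2 + c\<^sup>2 = 1" "s\<^sup>2 + C\<^sup>2 = 1" by (simp_all add: S_def c_def s_def C_def)
  have ang: "sin ((real k - 1) * \<theta>) = s * c - C * S" "sin ((real k + 1) * \<theta>) = s * c + C * S"
    "sin ((real (Suc k) - 1) * \<theta>) = s" "sin (real (Suc k) * \<theta>) = s * c + C * S"
    "sin ((real (Suc k) + 1) * \<theta>) = s * (c\<^sup>2 - S\<^sup>2) + C * (2 * S * c)"
  proof -
    have "(real (Suc k) + 1) * \<theta> = real k * \<theta> + 2 * \<theta>" by (simp add: algebra_simps)
    then show "sin ((real (Suc k) + 1) * \<theta>) = s * (c\<^sup>2 - S\<^sup>2) + C * (2 * S * c)"
      by (simp add: sin_add sin_double cos_double s_def C_def S_def c_def)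
  qed (simp_all add: algebra_simps sin_add sin_diff s_def C_def S_def c_def)
  have IH: "S\<^sup>2 * h l = S\<^sup>2 * f l
    - 2 * B i l * (f i * s\<^sup>2 + f j * s * (s * c - C * S))
    - 2 * B j l * (f i * s * (s * c + C * S) + f j * s\<^sup>2)" for l
    using Suc[of l] unfolding h_def ang(1,2) by (simp only: S_def s_def)
  have hi: "S\<^sup>2 * h i = S\<^sup>2 * f i - 2 * (f i * s\<^sup>2 + f j * s * (s * c - C * S))
      + 2 * c * (f i * s * (s * c + C * S) + f j * s\<^sup>2)"
    using IH[of i] B by (simp add: c_def)
  have hj: "S\<^sup>2 * h j = S\<^sup>2 * f j + 2 * c * (f i * s\<^sup>2 + f j * s * (s * c - C * S))
      - 2 * (f i * s * (s * c + C * S) + f j * s\<^sup>2)"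
    using IH[of j] B by (simp add: c_def)
  have step: "((reflection B j \<circ> reflection B i) ^^ Suc k) f l
      = h l - 2 * B i l * h i - 2 * B j l * (h j + 2 * c * h i)"
    using B by (simp add: h_def reflection_def c_def algebra_simps)
  \<comment> \<open>The coefficients of \<open>f i\<close> and \<open>f j\<close> in the two increments match by these two identities.\<close>
  have id1: "S\<^sup>2 - 2 * s\<^sup>2 + 2 * c * (s * (s * c + C * S)) = (s * c + C * S)\<^sup>2 - s\<^sup>2"
    using rel by algebra
  have id2: "2 * c * (s * c + C * S) - 2 * s = s * (c\<^sup>2 - S\<^sup>2) + C * (2 * S * c) - s"
    using rel by algebra
  have inc_i: "S\<^sup>2 * h i = f i * ((s * c + C * S)\<^sup>2 - s\<^sup>2)
      + f j * ((s * c + C * S) * s - s * (s * c - C * S))"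
    unfolding hi id1[symmetric] by (simp add: algebra_simps power2_eq_square)
  have "S\<^sup>2 * (h j + 2 * c * h i) = S\<^sup>2 * h j + 2 * c * (S\<^sup>2 * h i)"
    by (simp add: algebra_simps)
  also have "\<dots> = f i * ((s * c + C * S) * (2 * c * (s * c + C * S) - 2 * s))
      + f j * (S\<^sup>2 - 2 * s\<^sup>2 + 2 * c * (s * (s * c + C * S)))"
    unfolding hj inc_i by (simp add: algebra_simps power2_eq_square)
  finally have inc_j: "S\<^sup>2 * (h j + 2 * c * h i)
      = f i * ((s * c + C * S) * (s * (c\<^sup>2 - S\<^sup>2) + C * (2 * S * c)) - s * (s * c + C * S))
      + f j * ((s * c + C * S)\<^sup>2 - s\<^sup>2)"
    unfolding id1 id2 by (simp add: algebra_simps)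
  have "S\<^sup>2 * ((reflection B j \<circ> reflection B i) ^^ Suc k) f l
      = S\<^sup>2 * h l - 2 * B i l * (S\<^sup>2 * h i) - 2 * B j l * (S\<^sup>2 * (h j + 2 * c * h i))"
    unfolding step by (simp add: algebra_simps)
  also have "\<dots> = S\<^sup>2 * f l
    - 2 * B i l * (f i * (s * c + C * S)\<^sup>2 + f j * (s * c + C * S) * s)
    - 2 * B j l * (f i * (s * c + C * S) * (s * (c\<^sup>2 - S\<^sup>2) + C * (2 * S * c))
      + f j * (s * c + C * S)\<^sup>2)"
    unfolding IH[of l] inc_i inc_j by (simp add: algebra_simps)
  finally show ?case unfolding ang by (simp only: S_def)
qed

lemma reflection_pair_order:
  fixes m :: nat
  assumes B: "B i i = 1" "B j j = 1" "B i j = - cos (pi / m)" "B j i = - cos (pi / m)"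
    and m: "2 \<le> m"
  shows "(reflection B i \<circ> reflection B j) ^^ m = id"
proof -
  have "sin (pi / m) > 0" using m by (intro sin_gt_zero) (auto simp: field_simps)
  moreover have "sin (real m * (pi / real m)) = 0" using m by simp
  ultimately have "((reflection B i \<circ> reflection B j) ^^ m) f l = f l" for f l
    using reflection_pair_pow[OF B(2,1,4,3), of m f l] by simp
  then show ?thesis by (simp add: fun_eq_iff)
qed

section \<open>Braid relations in a group of permutations\<close>

text \<open>The function written first acts first: permutations act from the right here, so that a word
  is evaluated by reading it from left to right.\<close>

fun alt_comp :: "('x \<Rightarrow> 'x) \<Rightarrow> ('x \<Rightarrow> 'x) \<Rightarrow> nat \<Rightarrow> 'x \<Rightarrow> 'x" where
  "alt_comp F G 0 = id"
| "alt_comp F G (Suc k) = alt_comp G F k \<circ> F"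

text \<open>The action of \<open>(e(s), s)\<close>: the first coordinate is conjugated by \<open>s\<close>, and the second one
  counts the passages through \<open>s\<close>. The involution \<open>s\<close> represents a generator of a Coxeter group,
  and the first coordinate ranges over all functions to avoid a carrier set.\<close>

definition refl_step :: "('v \<Rightarrow> 'v) \<Rightarrow> ('v \<Rightarrow> 'v) \<times> int \<Rightarrow> ('v \<Rightarrow> 'v) \<times> int" where
  "refl_step s = (\<lambda>(r, c). (s \<circ> r \<circ> s, c + of_bool (r = s)))"

lemma involution_conj_conj:
  assumes "s \<circ> s = id"
  shows "s \<circ> (s \<circ> r \<circ> s) \<circ> s = r"
proof -
  have "s (s x) = x" for x using assms by (rule pointfree_idE)
  then show ?thesis by (simp add: fun_eq_iff)
qed

lemma involution_conj_fix:
  assumes "s \<circ> s = id"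
  shows "s \<circ> r \<circ> s = s \<longleftrightarrow> r = s"
proof
  assume "s \<circ> r \<circ> s = s"
  then have "r = s \<circ> s \<circ> s" using involution_conj_conj[OF assms, of r] by simp
  then show "r = s" using assms by simp
qed (simp add: assms)

lemma comp_funpow_swap: "s \<circ> (t \<circ> s) ^^ k = (s \<circ> t) ^^ k \<circ> s"
  by (induction k) (simp_all add: fun_eq_iff)

context
  fixes s t :: "'v \<Rightarrow> 'v"
  assumes invol: "s \<circ> s = id" "t \<circ> t = id"
begin

lemma invol_apply: "s (s x) = x" "t (t x) = x"
  using invol by (simp_all add: fun_eq_iff)

text \<open>As in any group, \<open>(st)\<^sup>k\<close> is the quotient of the two alternating products of length
  \<open>k\<close> of the involutions \<open>s\<close> and \<open>t\<close>. Hence the Coxeter relation of order \<open>m\<close> amounts to the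
  braid relation of length \<open>m\<close>, and the parity of \<open>m\<close> need not be distinguished. The two
  halves are proved together because each one uses the other as induction hypothesis.\<close>

lemma alt_comp_swap:
  "alt_comp s t k = alt_comp t s k \<circ> (t \<circ> s) ^^ k \<and> alt_comp t s k = alt_comp s t k \<circ> (s \<circ> t) ^^ k"
proof (induction k)
  case (Suc k)
  have "alt_comp s t (Suc k) = alt_comp s t k \<circ> ((s \<circ> t) ^^ k \<circ> s)"
    by (simp only: alt_comp.simps conjunct2[OF Suc] comp_assoc)
  also have "(s \<circ> t) ^^ k \<circ> s = t \<circ> (t \<circ> s) ^^ Suc k"
    unfolding comp_funpow_swap[symmetric] by (simp add: fun_eq_iff invol_apply)
  finally have 1: "alt_comp s t (Suc k) = alt_comp t s (Suc k) \<circ> (t \<circ> s) ^^ Suc k"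
    by (simp only: alt_comp.simps comp_assoc)
  have "alt_comp t s (Suc k) = alt_comp t s k \<circ> ((t \<circ> s) ^^ k \<circ> t)"
    by (simp only: alt_comp.simps conjunct1[OF Suc] comp_assoc)
  also have "(t \<circ> s) ^^ k \<circ> t = s \<circ> (s \<circ> t) ^^ Suc k"
    unfolding comp_funpow_swap[symmetric] by (simp add: fun_eq_iff invol_apply)
  finally have "alt_comp t s (Suc k) = alt_comp s t (Suc k) \<circ> (s \<circ> t) ^^ Suc k"
    by (simp only: alt_comp.simps comp_assoc)
  with 1 show ?case by blast
qed simp

lemma funpow_inverse: "(s \<circ> t) ^^ l \<circ> (t \<circ> s) ^^ l = id"
proof (induction l)
  case (Suc l)
  have "(s \<circ> t) ^^ Suc l \<circ> (t \<circ> s) ^^ Suc l = (s \<circ> t) ^^ l \<circ> ((s \<circ> t) \<circ> (t \<circ> s)) \<circ> (t \<circ> s) ^^ l"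
    unfolding funpow_Suc_right[of l "s \<circ> t"] funpow.simps(2)[of l "t \<circ> s"] by (simp only: comp_assoc)
  also have "(s \<circ> t) \<circ> (t \<circ> s) = id" by (simp add: fun_eq_iff invol_apply)
  finally show ?case using Suc by simp
qed simp

lemma conj_eq_iff: "s \<circ> r \<circ> s = (t \<circ> s) ^^ l \<circ> t \<longleftrightarrow> r = (s \<circ> t) ^^ Suc l \<circ> s"
proof -
  have "s \<circ> r \<circ> s = w \<longleftrightarrow> r = s \<circ> w \<circ> s" for w
    using involution_conj_conj[OF invol(1)] by metis
  moreover have "s \<circ> ((t \<circ> s) ^^ l \<circ> t) \<circ> s = (s \<circ> t) ^^ Suc l \<circ> s"
    by (simp only: comp_assoc[symmetric] comp_funpow_swap)
       (simp only: comp_assoc funpow_Suc_right)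
  ultimately show ?thesis by simp
qed

end

text \<open>Starting from \<open>r\<close>, the counter increases at step \<open>l\<close> exactly if \<open>r\<close> is the reflection
  \<open>(st)\<^sup>l s\<close>. The first coordinate \<open>r'\<close> is described by an intertwining equation instead of
  as a conjugate, which spares the inverse of the alternating product.\<close>

lemma alt_comp_refl_step:
  assumes "s \<circ> s = id" "t \<circ> t = id"
  shows "\<exists>r'. alt_comp (refl_step s) (refl_step t) k (r, c)
      = (r', c + (\<Sum>l<k. of_bool (r = (s \<circ> t) ^^ l \<circ> s)))
    \<and> r' \<circ> alt_comp s t k = alt_comp s t k \<circ> r"
  using assms
proof (induction k arbitrary: s t r c)
  case 0
  then show ?case by simp
next
  case (Suc k)
  let ?c = "c + of_bool (r = s)"
  obtain r' where r': "alt_comp (refl_step t) (refl_step s) k (s \<circ> r \<circ> s, ?c)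
      = (r', ?c + (\<Sum>l<k. of_bool (s \<circ> r \<circ> s = (t \<circ> s) ^^ l \<circ> t)))"
    and conj: "r' \<circ> alt_comp t s k = alt_comp t s k \<circ> (s \<circ> r \<circ> s)"
    using Suc.IH[OF Suc.prems(2,1), of "s \<circ> r \<circ> s" ?c] by blast
  have "alt_comp (refl_step s) (refl_step t) (Suc k) (r, c)
      = alt_comp (refl_step t) (refl_step s) k (s \<circ> r \<circ> s, ?c)"
    by (simp add: refl_step_def)
  also have "\<dots> = (r', c + (\<Sum>l<Suc k. of_bool (r = (s \<circ> t) ^^ l \<circ> s)))"
    unfolding r' conj_eq_iff[OF Suc.prems]
    by (simp add: sum.lessThan_Suc_shift del: sum.lessThan_Suc funpow.simps)
       simp
  finally have 1: "alt_comp (refl_step s) (refl_step t) (Suc k) (r, c)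
      = (r', c + (\<Sum>l<Suc k. of_bool (r = (s \<circ> t) ^^ l \<circ> s)))" .
  have "r' \<circ> alt_comp s t (Suc k) = alt_comp s t (Suc k) \<circ> r"
    using conj Suc.prems(1) by (simp add: fun_eq_iff)
  then show ?case using 1 by blast
qed

lemma bij_alt_comp: "bij F \<Longrightarrow> bij G \<Longrightarrow> bij (alt_comp F G k)"
  by (induction k arbitrary: F G) (auto intro: bij_comp)

lemma bij_involution: "s \<circ> s = id \<Longrightarrow> bij s"
  by (rule o_bij)

text \<open>The Coxeter relation turns \<open>(ts)\<^sup>l t\<close> into \<open>(st)\<^bsup>m-1-l\<^esup> s\<close>, so the two alternating products
  pass through the same reflections in opposite orders and their counters agree.\<close>

lemma refl_step_braid:
  assumes st: "s \<circ> s = id" "t \<circ> t = id" and ord: "(s \<circ> t) ^^ m = id"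
  shows "alt_comp (refl_step s) (refl_step t) m = alt_comp (refl_step t) (refl_step s) m"
proof
  fix x :: "('a \<Rightarrow> 'a) \<times> int"
  obtain r c where x: "x = (r, c)" by force
  obtain r1 where r1: "alt_comp (refl_step s) (refl_step t) m (r, c)
      = (r1, c + (\<Sum>l<m. of_bool (r = (s \<circ> t) ^^ l \<circ> s)))"
    "r1 \<circ> alt_comp s t m = alt_comp s t m \<circ> r"
    using alt_comp_refl_step[OF st] by blast
  obtain r2 where r2: "alt_comp (refl_step t) (refl_step s) m (r, c)
      = (r2, c + (\<Sum>l<m. of_bool (r = (t \<circ> s) ^^ l \<circ> t)))"
    "r2 \<circ> alt_comp t s m = alt_comp t s m \<circ> r"
    using alt_comp_refl_step[OF st(2,1)] by blast
  have alt: "alt_comp s t m = alt_comp t s m"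
    using conjunct2[OF alt_comp_swap[OF st, of m]] ord by simp
  have "surj (alt_comp s t m)"
    using st by (intro bij_is_surj bij_alt_comp bij_involution)
  moreover have "r1 \<circ> alt_comp s t m = r2 \<circ> alt_comp s t m"
    using r1(2) r2(2)[folded alt] by simp
  ultimately have "r1 = r2" by (metis comp_apply ext surjD)
  moreover have "(\<Sum>l<m. of_bool (r = (t \<circ> s) ^^ l \<circ> t)) = (\<Sum>l<m. of_bool (r = (s \<circ> t) ^^ l \<circ> s) :: int)"
  proof -
    have "(t \<circ> s) ^^ l \<circ> t = (s \<circ> t) ^^ (m - Suc l) \<circ> s" if "l < m" for l
    proof -
      have "m = (m - l) + l" using that by simp
      then have "(s \<circ> t) ^^ (m - l) \<circ> (s \<circ> t) ^^ l = id"
        using ord by (metis funpow_add)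
      then have "(t \<circ> s) ^^ l = (s \<circ> t) ^^ (m - l)"
        using funpow_inverse[OF st, of l] by (metis comp_assoc comp_id id_comp)
      also have "m - l = Suc (m - Suc l)" using that by simp
      finally show ?thesis
        using st(2) by (simp only: funpow_Suc_right comp_assoc comp_id)
    qed
    then have "(\<Sum>l<m. of_bool (r = (t \<circ> s) ^^ l \<circ> t))
        = (\<Sum>l<m. of_bool (r = (s \<circ> t) ^^ (m - Suc l) \<circ> s) :: int)"
      by (intro sum.cong) auto
    also have "\<dots> = (\<Sum>l<m. of_bool (r = (s \<circ> t) ^^ l \<circ> s))"
      by (rule sum.nat_diff_reindex)
    finally show ?thesis .
  qed
  ultimately show "alt_comp (refl_step s) (refl_step t) m x = alt_comp (refl_step t) (refl_step s) m x"
    unfolding x r1(1) r2(1) by simp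
qed

section \<open>Permutations commuting with the shift\<close>

definition shift :: "int \<Rightarrow> 'r \<times> int \<Rightarrow> 'r \<times> int" where
  "shift k = (\<lambda>(r, c). (r, c + k))"

definition shift_perms :: "('r \<times> int \<Rightarrow> 'r \<times> int) monoid" where
  "shift_perms = \<lparr>carrier = {F. bij F \<and> (\<forall>k. F \<circ> shift k = shift k \<circ> F)},
     mult = (\<lambda>F G. G \<circ> F), one = id\<rparr>"

text \<open>A conjugacy invariant in \<open>shift_perms\<close>: for a permutation \<open>(r, c) \<mapsto> (r, c + v r)\<close> it is
  the set of values of \<open>v\<close>.\<close>

definition displacements :: "('r \<times> int \<Rightarrow> 'r \<times> int) \<Rightarrow> int set" where
  "displacements F = {k. \<exists>x. F x = shift k x}"

lemma shift_perms_simps [simp]: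
  "F \<in> carrier shift_perms \<longleftrightarrow> bij F \<and> (\<forall>k. F \<circ> shift k = shift k \<circ> F)"
  "mult shift_perms F G = G \<circ> F"
  "one shift_perms = id"
  by (simp_all add: shift_perms_def)

lemma shift_perms_commute:
  assumes "F \<in> carrier shift_perms"
  shows "F (shift k x) = shift k (F x)"
proof -
  have "F \<circ> shift k = shift k \<circ> F" using assms by simp
  then show ?thesis by (rule comp_eq_dest)
qed

lemma group_shift_perms: "group shift_perms"
proof (rule groupI)
  fix F G :: "'a \<times> int \<Rightarrow> 'a \<times> int"
  assume F: "F \<in> carrier shift_perms"
  let ?I = "inv_into UNIV F"
  have "?I \<circ> shift k = shift k \<circ> ?I" for k
  proof
    fix x
    obtain y where x: "x = F y" using F bij_is_surj by (metis shift_perms_simps(1) surjD)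
    have "shift k (F y) = F (shift k y)" by (rule shift_perms_commute[OF F, symmetric])
    then show "(?I \<circ> shift k) x = (shift k \<circ> ?I) x"
      using F x by (simp add: bij_is_inj)
  qed
  then show "\<exists>G\<in>carrier shift_perms. G \<otimes>\<^bsub>shift_perms\<^esub> F = \<one>\<^bsub>shift_perms\<^esub>"
    using F bij_is_surj[of F, unfolded surj_iff]
    by (intro bexI[of _ ?I]) (auto simp: bij_imp_bij_inv)
  assume G: "G \<in> carrier shift_perms"
  show "F \<otimes>\<^bsub>shift_perms\<^esub> G \<in> carrier shift_perms"
    using F G shift_perms_commute[OF F] shift_perms_commute[OF G]
    by (simp add: bij_comp fun_eq_iff del: split_paired_All)
qed (auto simp: comp_assoc)

text \<open>As the inverse of \<open>H\<close> commutes with the shift, it maps the points that \<open>F\<close> moves by \<open>k\<close> to points that the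
  conjugate of \<open>F\<close> moves by \<open>k\<close>. An inclusion suffices to separate conjugacy classes below.\<close>

lemma displacements_conj:
  assumes F: "F \<in> carrier shift_perms" and H: "H \<in> carrier shift_perms"
  shows "displacements F \<subseteq> displacements (H \<otimes>\<^bsub>shift_perms\<^esub> F \<otimes>\<^bsub>shift_perms\<^esub> inv\<^bsub>shift_perms\<^esub> H)"
proof
  interpret group shift_perms by (rule group_shift_perms)
  let ?I = "inv\<^bsub>shift_perms\<^esub> H"
  have I: "?I \<in> carrier shift_perms" using H by (rule inv_closed)
  fix k assume "k \<in> displacements F"
  then obtain x where x: "F x = shift k x" by (auto simp: displacements_def)
  have "H \<circ> ?I = id" using l_inv[OF H] by simp
  then have "H (?I x) = x" by (rule pointfree_idE)
  then have "(H \<otimes>\<^bsub>shift_perms\<^esub> F \<otimes>\<^bsub>shift_perms\<^esub> ?I) (?I x) = ?I (shift k x)"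
    by (simp add: x)
  also have "\<dots> = shift k (?I x)" by (rule shift_perms_commute[OF I])
  finally show "k \<in> displacements (H \<otimes>\<^bsub>shift_perms\<^esub> F \<otimes>\<^bsub>shift_perms\<^esub> ?I)"
    unfolding displacements_def by blast
qed

lemma refl_step_closed:
  assumes "s \<circ> s = id"
  shows "refl_step s \<in> carrier shift_perms"
proof -
  note conj = involution_conj_conj[OF assms] and fix_iff = involution_conj_fix[OF assms]
  let ?I = "\<lambda>(r, c). (s \<circ> r \<circ> s, c - of_bool (r = s))"
  have "(?I \<circ> refl_step s) x = id x" "(refl_step s \<circ> ?I) x = id x" for x
    by (cases x; simp add: refl_step_def conj fix_iff)+
  then have "bij (refl_step s)" by (intro o_bij[of ?I] ext)
  moreover have "refl_step s \<circ> shift k = shift k \<circ> refl_step s" for k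
    by (auto simp: refl_step_def shift_def)
  ultimately show ?thesis by simp
qed

lemma refl_step_even_pow:
  assumes "s \<circ> s = id"
  shows "refl_step s [^]\<^bsub>shift_perms\<^esub> (2 * k :: nat)
    = (\<lambda>(r, c). (r, c + 2 * int k * of_bool (r = s)))"
proof -
  note conj = involution_conj_conj[OF assms] and fix_iff = involution_conj_fix[OF assms]
  have two: "refl_step s (refl_step s (r, c)) = (r, c + 2 * of_bool (r = s))" for r c
    by (simp add: refl_step_def conj fix_iff)
  show ?thesis
  proof (induction k)
    case (Suc k)
    have "refl_step s [^]\<^bsub>shift_perms\<^esub> (2 * Suc k)
        = refl_step s \<circ> (refl_step s \<circ> refl_step s [^]\<^bsub>shift_perms\<^esub> (2 * k))"
      by simp
    then show ?case unfolding Suc by (auto simp: two algebra_simps)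
  qed auto
qed

section \<open>Artin groups\<close>

lemma word_value_alt_word_integer_group:
  "word_value integer_group (\<lambda>_. 1) (alt_word x y k) = int k"
  by (induction k arbitrary: x y) (simp_all add: letter_value_def)

lemma word_value_alt_word_shift_perms:
  "word_value shift_perms f (alt_word x y k) = alt_comp (f x) (f y) k"
  by (induction k arbitrary: x y) (simp_all add: letter_value_def)

lemma artin_group_degree:
  obtains d where "d \<in> hom (presented_group {1..n} (artin_relations n m)) integer_group"
    and "\<And>i. i \<in> {1..n} \<Longrightarrow> d (pres_gen {1..n} (artin_relations n m) i) = 1"
proof (rule group.presented_group_hom_exists[of integer_group "\<lambda>_. 1" "{1..n}" "artin_relations n m"])
  fix r s assume "(r, s) \<in> artin_relations n m"
  then show "word_value integer_group (\<lambda>_. 1) r = word_value integer_group (\<lambda>_. 1) s"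
    by (auto simp: artin_relations_def word_value_alt_word_integer_group)
qed (use that in auto)

text \<open>The Gram matrix of the simple roots; its entry \<open>-1\<close> at a pair without relation is the limit
  of \<open>- cos (pi / k)\<close> for \<open>k \<rightarrow> \<infinity>\<close>.\<close>

definition cosine_matrix :: "(nat \<Rightarrow> nat \<Rightarrow> enat) \<Rightarrow> nat \<Rightarrow> nat \<Rightarrow> real" where
  "cosine_matrix m i j =
    (if i = j then 1 else case m i j of enat k \<Rightarrow> - cos (pi / k) | \<infinity> \<Rightarrow> - 1)"

text \<open>The pair \<open>\<sigma> i\<close>, \<open>\<sigma> j\<close> satisfies the Coxeter relation, hence the associated permutations
  satisfy the braid relation that defines the Artin group.\<close>

lemma artin_group_action:
  assumes m: "artin_matrix n m"
  defines "\<sigma> \<equiv> reflection (cosine_matrix m)"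
  obtains h where "h \<in> hom (presented_group {1..n} (artin_relations n m)) shift_perms"
    and "\<And>i. i \<in> {1..n} \<Longrightarrow> h (pres_gen {1..n} (artin_relations n m) i) = refl_step (\<sigma> i)"
proof (rule group.presented_group_hom_exists
    [of shift_perms "\<lambda>i. refl_step (\<sigma> i)" "{1..n}" "artin_relations n m"])
  have inv: "\<sigma> i \<circ> \<sigma> i = id" for i
    unfolding \<sigma>_def by (rule reflection_involution) (simp add: cosine_matrix_def)
  then show "(\<lambda>i. refl_step (\<sigma> i)) \<in> {1..n} \<rightarrow> carrier shift_perms"
    using refl_step_closed by blast
  fix r s assume "(r, s) \<in> artin_relations n m"
  then obtain i j k where rs: "r = alt_word i j k" "s = alt_word j i k"
    and ij: "1 \<le> i" "i < j" "j \<le> n" "m i j = enat k"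
    unfolding artin_relations_def by blast
  have mij: "m i j = m j i \<and> 2 \<le> m i j"
  proof -
    have "i \<in> {1..n}" "j \<in> {1..n}" "i \<noteq> j" using ij(1-3) by simp_all
    then show ?thesis using m unfolding artin_matrix_def by blast
  qed
  have mji: "m j i = enat k" using conjunct1[OF mij] ij(4) by simp
  have k: "2 \<le> k" using conjunct2[OF mij] ij(4) by simp
  have "(\<sigma> i \<circ> \<sigma> j) ^^ k = id"
    unfolding \<sigma>_def using ij mji k
    by (intro reflection_pair_order) (auto simp: cosine_matrix_def)
  then show "word_value shift_perms (\<lambda>i. refl_step (\<sigma> i)) r
      = word_value shift_perms (\<lambda>i. refl_step (\<sigma> i)) s"
    unfolding rs word_value_alt_word_shift_perms by (intro refl_step_braid inv)
qed (use that group_shift_perms in auto)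

text \<open>The two permutations are translations of the second coordinate, by the function with values
  \<open>2k+2\<close> at \<open>s\<close>, \<open>-2k\<close> at \<open>t\<close> and \<open>0\<close> elsewhere, and by the same function for \<open>l\<close>. The
  only positive value is the one at \<open>s\<close>.\<close>

lemma displacements_separate:
  assumes s: "s \<circ> s = id" and t: "t \<circ> t = id" and st: "s \<noteq> t"
    and eq: "displacements (refl_step s [^]\<^bsub>shift_perms\<^esub> (2 * Suc k)
        \<otimes>\<^bsub>shift_perms\<^esub> inv\<^bsub>shift_perms\<^esub> (refl_step t [^]\<^bsub>shift_perms\<^esub> (2 * k)))
      \<subseteq> displacements (refl_step s [^]\<^bsub>shift_perms\<^esub> (2 * Suc l)
        \<otimes>\<^bsub>shift_perms\<^esub> inv\<^bsub>shift_perms\<^esub> (refl_step t [^]\<^bsub>shift_perms\<^esub> (2 * l)))"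
  shows "k = l"
proof -
  interpret group shift_perms by (rule group_shift_perms)
  have inv: "inv\<^bsub>shift_perms\<^esub> (refl_step t [^]\<^bsub>shift_perms\<^esub> (2 * j))
      = (\<lambda>(r, c). (r, c - 2 * int j * of_bool (r = t)))" (is "_ = ?I") for j :: nat
  proof (rule inv_equality)
    show "refl_step t [^]\<^bsub>shift_perms\<^esub> (2 * j) \<in> carrier shift_perms"
      by (rule nat_pow_closed[OF refl_step_closed[OF t]])
    show "?I \<otimes>\<^bsub>shift_perms\<^esub> refl_step t [^]\<^bsub>shift_perms\<^esub> (2 * j) = \<one>\<^bsub>shift_perms\<^esub>"
      unfolding refl_step_even_pow[OF t] by auto
    have "bij ?I"
      by (rule o_bij[of "\<lambda>(r, c). (r, c + 2 * int j * of_bool (r = t))"]) auto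
    then show "?I \<in> carrier shift_perms" by (auto simp: shift_def)
  qed
  have "displacements (refl_step s [^]\<^bsub>shift_perms\<^esub> (2 * Suc j)
        \<otimes>\<^bsub>shift_perms\<^esub> inv\<^bsub>shift_perms\<^esub> (refl_step t [^]\<^bsub>shift_perms\<^esub> (2 * j)))
      = {2 * int (Suc j) * of_bool (r = s) - 2 * int j * of_bool (r = t) | r. True}" for j
    unfolding inv refl_step_even_pow[OF s] displacements_def shift_def
    by (auto simp: prod_eq_iff)
  note disp = this
  have "2 * int (Suc k) \<in> {2 * int (Suc k) * of_bool (r = s) - 2 * int k * of_bool (r = t) | r. True}"
    using st by force
  then obtain r where "2 * int (Suc k) = 2 * int (Suc l) * of_bool (r = s) - 2 * int l * of_bool (r = t)"
    using eq unfolding disp by blast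
  then show ?thesis by (cases "r = s"; cases "r = t") (use st in auto)
qed

text \<open>With \<open>a\<close> and \<open>b\<close> the first two generators, the elements \<open>a\<^bsup>2k+2\<^esup> b\<^bsup>-2k\<^esup>\<close> have degree \<open>2\<close>
  and are separated by the displacements of their images. Even exponents make these
  images pure translations, and exponents of both signs are what allows infinitely many
  elements of the same degree.\<close>

theorem artin_group_not_BVC:
  assumes A: "group A" and m: "artin_matrix n m" and n: "2 \<le> n"
    and iso: "A \<cong> presented_group {1..n} (artin_relations n m)"
  shows "\<not> BVC A"
proof -
  let ?P = "presented_group {1..n} (artin_relations n m)"
  let ?x = "pres_gen {1..n} (artin_relations n m)"
  interpret A: group A by fact
  interpret P: group ?P by (rule group_presented_group)
  interpret Q: group shift_perms by (rule group_shift_perms)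
  obtain d where d: "d \<in> hom ?P integer_group" "\<And>i. i \<in> {1..n} \<Longrightarrow> d (?x i) = 1"
    by (rule artin_group_degree[of n m]) (rule that)
  define \<sigma> where "\<sigma> = reflection (cosine_matrix m)"
  obtain h where h: "h \<in> hom ?P shift_perms" "\<And>i. i \<in> {1..n} \<Longrightarrow> h (?x i) = refl_step (\<sigma> i)"
    using artin_group_action[OF m] unfolding \<sigma>_def by blast
  interpret d: group_hom ?P integer_group d
    by (intro group_hom.intro group_hom_axioms.intro P.group_axioms group_integer_group d(1))
  interpret h: group_hom ?P shift_perms h
    by (intro group_hom.intro group_hom_axioms.intro P.group_axioms Q.group_axioms h(1))
  obtain \<phi> where \<phi>: "\<phi> \<in> iso A ?P" using iso by (auto simp: is_iso_def)
  have \<phi>_hom: "\<phi> \<in> hom A ?P" and \<phi>_bij: "bij_betw \<phi> (carrier A) (carrier ?P)"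
    using \<phi> by (auto simp: iso_def)
  interpret \<phi>: group_hom A ?P \<phi>
    by (intro group_hom.intro group_hom_axioms.intro A P.group_axioms \<phi>_hom)
  have inv: "\<sigma> i \<circ> \<sigma> i = id" for i
    unfolding \<sigma>_def by (rule reflection_involution) (simp add: cosine_matrix_def)
  have neq: "\<sigma> 1 \<noteq> \<sigma> 2"
    unfolding \<sigma>_def by (rule reflection_neq) (simp_all add: cosine_matrix_def)
  obtain a b where a: "a \<in> carrier ?P" "d a = 1" "h a = refl_step (\<sigma> 1)"
    and b: "b \<in> carrier ?P" "d b = 1" "h b = refl_step (\<sigma> 2)"
  proof
    have "1 \<in> {1..n}" "2 \<in> {1..n}" using n by simp_all
    note 12 = this
    show "?x 1 \<in> carrier ?P" "?x 2 \<in> carrier ?P" by (rule pres_gen_closed, rule 12)+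
    show "d (?x 1) = 1" "d (?x 2) = 1" by (rule d(2), rule 12)+
    show "h (?x 1) = refl_step (\<sigma> 1)" "h (?x 2) = refl_step (\<sigma> 2)" by (rule h(2), rule 12)+
  qed
  define p where "p k = a [^]\<^bsub>?P\<^esub> (2 * Suc k) \<otimes>\<^bsub>?P\<^esub> inv\<^bsub>?P\<^esub> (b [^]\<^bsub>?P\<^esub> (2 * k))" for k
  have p: "p k \<in> carrier ?P" for k
    unfolding p_def by (intro P.m_closed P.inv_closed P.nat_pow_closed a b)
  have dp: "d (p k) = 2" for k
    unfolding p_def
    by (simp only: d.hom_mult d.hom_inv d.hom_nat_pow P.nat_pow_closed P.inv_closed a b) simp
  have hp: "h (p k) = refl_step (\<sigma> 1) [^]\<^bsub>shift_perms\<^esub> (2 * Suc k)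
      \<otimes>\<^bsub>shift_perms\<^esub> inv\<^bsub>shift_perms\<^esub> (refl_step (\<sigma> 2) [^]\<^bsub>shift_perms\<^esub> (2 * k))" for k
    unfolding p_def
    by (simp only: h.hom_mult h.hom_inv h.hom_nat_pow P.nat_pow_closed P.inv_closed a b)
  define g where "g k = inv_into (carrier A) \<phi> (p k)" for k
  have \<phi>g: "\<phi> (g k) = p k" and g: "g k \<in> carrier A" for k
    using p \<phi>_bij unfolding g_def by (auto simp: bij_betw_def f_inv_into_f inv_into_into)
  show ?thesis
  proof (rule not_BVC_if_infinitely_many_classes[OF A, of "d \<circ> \<phi>" 2 g])
    show "d \<circ> \<phi> \<in> hom A integer_group" using hom_compose[OF \<phi>_hom d(1)] .
    show "(d \<circ> \<phi>) (g k) = 2" for k by (simp add: \<phi>g dp)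
    fix k l c assume c: "c \<in> carrier A" and eq: "c \<otimes>\<^bsub>A\<^esub> g k \<otimes>\<^bsub>A\<^esub> inv\<^bsub>A\<^esub> c = g l"
    have "p l = \<phi> c \<otimes>\<^bsub>?P\<^esub> p k \<otimes>\<^bsub>?P\<^esub> inv\<^bsub>?P\<^esub> \<phi> c"
      using arg_cong[OF eq, of \<phi>] c g by (simp add: \<phi>g)
    then have "h (p l) = h (\<phi> c) \<otimes>\<^bsub>shift_perms\<^esub> h (p k) \<otimes>\<^bsub>shift_perms\<^esub> inv\<^bsub>shift_perms\<^esub> h (\<phi> c)"
      using c p[of k] by (simp only: h.hom_mult h.hom_inv P.m_closed P.inv_closed \<phi>.hom_closed)
    then have "displacements (h (p k)) \<subseteq> displacements (h (p l))"
      using displacements_conj[OF h.hom_closed[OF p] h.hom_closed[OF \<phi>.hom_closed[OF c]]] by metis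
    then show "k = l"
      unfolding hp by (rule displacements_separate[OF inv inv neq])
  qed (simp_all add: g)
qed

theorem theoremA:
  fixes A :: "('a, 'b) monoid_scheme"
  assumes "artin_group A"
  shows "BVC A \<longleftrightarrow> virtually_cyclic A"
proof
  from assms obtain n m where A: "group A" "artin_matrix n m"
    "A \<cong> presented_group {1..n} (artin_relations n m)"
    unfolding artin_group_def by blast
  show "virtually_cyclic A" if "BVC A"
  proof -
    have "n \<le> 1" using artin_group_not_BVC[OF A(1,2) _ A(3)] that by force
    then have "{1..n} \<subseteq> {1}" by auto
    from presented_group_cyclic[OF this] have "cyclic_group A"
      using isomorphic_group_cyclicity[OF A(3,1) group_presented_group] by blast
    then show ?thesis using A(1) by (rule virtually_cyclic_if_cyclic_group[rotated])
  qed
  show "BVC A" if "virtually_cyclic A" using A(1) that by (rule BVC_if_virtually_cyclic)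
qed

end
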